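(* Let $I\subset\mathbb{R}$ be an open interval and let $\alpha: I\to E^4$ be a curve parametrized by arc length $s$, with parallel transport frame $\{T,M_1,M_2,M_3\}$ and corresponding curvature functions $k_1,k_2,k_3$, each nowhere zero on $I$. Then $\alpha$ is an inclined curve if and only if $$k_1(s)\int k_1(s)\,ds+k_2(s)\int k_2(s)\,ds+k_3(s)\int k_3(s)\,ds=0 ,$$ that is, if and only if there exist antiderivatives $K_1,K_2,K_3: I\to\mathbb{R}$ of $k_1,k_2,k_3$ (i.e. $K_i'=k_i$) such that $k_1(s)K_1(s)+k_2(s)K_2(s)+k_3(s)K_3(s)=0$ for all $s\in I$.
   Context: $E^4$ is $\mathbb{R}^4$ with the standard inner product $\langle\cdot,\cdot\rangle$. All curves, frames and functions are assumed smooth. Parallel transport frame: for a unit speed curve $\alpha: I\to E^4$ with $T=\alpha'$, a parallel transport frame is an orthonormal frame field $\{T,M_1,M_2,M_3\}$ along $\alpha$ such that $$T'=k_1M_1+k_2M_2+k_3M_3,\qquad M_i'=-k_iT\quad(i=1,2,3),$$ where $k_i=\langle T',M_i\rangle$ are the curvature functions of $\alpha$ according to this frame. Inclined curve: a unit speed curve $\alpha: I\to E^4$ is an inclined curve if there is a fixed unit vector $X\in E^4$ and a constant angle $\varphi\neq\frac{\pi}{2}$ with $\langle\alpha'(s),X\rangle=\cos\varphi$ for all $s\in I$. *)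

theory Defs
  imports "HOL-Analysis.Analysis"
begin

text \<open>Curves, frame fields and functions on an open interval are total functions on the reals;
  only their values on that open interval matter. Since the interval is open, the
  derivatives (at \<open>t\<close>) below depend only on those values.\<close>

definition smooth_on :: "real set \<Rightarrow> (real \<Rightarrow> 'a::real_normed_vector) \<Rightarrow> bool" where
  "smooth_on I f \<longleftrightarrow>
     (\<forall>n. \<forall>t\<in>I. ((\<lambda>g t. vector_derivative g (at t)) ^^ n) f differentiable at t)"

definition tangent :: "(real \<Rightarrow> real^4) \<Rightarrow> real \<Rightarrow> real^4" where
  "tangent \<alpha> s = vector_derivative \<alpha> (at s)"

definition unit_speed_curve :: "real set \<Rightarrow> (real \<Rightarrow> real^4) \<Rightarrow> bool" where
  "unit_speed_curve I \<alpha> \<longleftrightarrow> smooth_on I \<alpha> \<and> (\<forall>s\<in>I. norm (tangent \<alpha> s) = 1)"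

definition frame_curvature :: "(real \<Rightarrow> real^4) \<Rightarrow> (real \<Rightarrow> real^4) \<Rightarrow> real \<Rightarrow> real" where
  "frame_curvature \<alpha> M s = vector_derivative (tangent \<alpha>) (at s) \<bullet> M s"

text \<open>Spelled out vector by vector, so that coinciding vectors are excluded (which orthogonality
  of the set of the four vectors would not do).\<close>

definition orthonormal4 :: "real^4 \<Rightarrow> real^4 \<Rightarrow> real^4 \<Rightarrow> real^4 \<Rightarrow> bool" where
  "orthonormal4 v0 v1 v2 v3 \<longleftrightarrow>
     norm v0 = 1 \<and> norm v1 = 1 \<and> norm v2 = 1 \<and> norm v3 = 1 \<and>
     v0 \<bullet> v1 = 0 \<and> v0 \<bullet> v2 = 0 \<and> v0 \<bullet> v3 = 0 \<and> v1 \<bullet> v2 = 0 \<and> v1 \<bullet> v3 = 0 \<and> v2 \<bullet> v3 = 0"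

definition parallel_transport_frame ::
  "real set \<Rightarrow> (real \<Rightarrow> real^4) \<Rightarrow> (real \<Rightarrow> real^4) \<Rightarrow> (real \<Rightarrow> real^4) \<Rightarrow> (real \<Rightarrow> real^4) \<Rightarrow> bool"
where
  "parallel_transport_frame I \<alpha> M1 M2 M3 \<longleftrightarrow>
     smooth_on I M1 \<and> smooth_on I M2 \<and> smooth_on I M3 \<and>
     (\<forall>s\<in>I.
        orthonormal4 (tangent \<alpha> s) (M1 s) (M2 s) (M3 s) \<and>
        (tangent \<alpha> has_vector_derivative
           (frame_curvature \<alpha> M1 s *\<^sub>R M1 s + frame_curvature \<alpha> M2 s *\<^sub>R M2 s
            + frame_curvature \<alpha> M3 s *\<^sub>R M3 s)) (at s) \<and>
        (M1 has_vector_derivative (- frame_curvature \<alpha> M1 s *\<^sub>R tangent \<alpha> s)) (at s) \<and>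
        (M2 has_vector_derivative (- frame_curvature \<alpha> M2 s *\<^sub>R tangent \<alpha> s)) (at s) \<and>
        (M3 has_vector_derivative (- frame_curvature \<alpha> M3 s *\<^sub>R tangent \<alpha> s)) (at s))"

text \<open>An angle between vectors lies in \<open>[0, \<pi>]\<close>; without this restriction the condition
  \<open>\<phi> \<noteq> \<pi>/2\<close> would still admit \<open>cos \<phi> = 0\<close>.\<close>

definition inclined_curve :: "real set \<Rightarrow> (real \<Rightarrow> real^4) \<Rightarrow> bool" where
  "inclined_curve I \<alpha> \<longleftrightarrow> unit_speed_curve I \<alpha> \<and>
     (\<exists>X \<phi>. norm X = 1 \<and> 0 \<le> \<phi> \<and> \<phi> \<le> pi \<and> \<phi> \<noteq> pi / 2 \<and>
        (\<forall>s\<in>I. tangent \<alpha> s \<bullet> X = cos \<phi>))"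

end

theory Submission
  imports Defs
begin

text \<open>If \<open>\<langle>T, X\<rangle> = c \<noteq> 0\<close> then \<open>K\<^sub>i = - \<langle>M\<^sub>i, X\<rangle> / c\<close> are antiderivatives of the curvatures, and
  the relation is the derivative of \<open>\<langle>T, X\<rangle>\<close>. Conversely, the relation says exactly that
  \<open>T - K\<^sub>1 M\<^sub>1 - K\<^sub>2 M\<^sub>2 - K\<^sub>3 M\<^sub>3\<close> is a constant vector; its inner product with \<open>T\<close> is \<open>1\<close>, so its
  direction is the axis.\<close>

lemma has_real_derivative_inner_left:
  fixes M :: "real \<Rightarrow> 'a::real_inner"
  assumes "(M has_vector_derivative M') (at s)"
  shows "((\<lambda>t. M t \<bullet> X) has_real_derivative M' \<bullet> X) (at s)"
  using bounded_linear.has_vector_derivative[OF bounded_linear_inner_left assms]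
  by (simp add: has_real_derivative_iff_has_vector_derivative)

text \<open>Produces an axis from a vector \<open>Y\<close> of unknown length. When \<open>I\<close>
  is nonempty, Cauchy-Schwarz against a unit tangent gives \<open>norm Y\<close> at least 1, so
  \<open>1 / norm Y\<close> lies in (0,1]. It is therefore the cosine of an angle in [0, pi] other
  than pi/2, and normalising \<open>Y\<close> gives the unit axis.\<close>

lemma inclined_curveI:
  assumes "unit_speed_curve I \<alpha>" and inner: "\<And>s. s \<in> I \<Longrightarrow> tangent \<alpha> s \<bullet> Y = 1"
  shows "inclined_curve I \<alpha>"
proof (cases "I = {}")
  case True
  \<comment> \<open>With no point of \<open>I\<close> available, \<open>Y\<close> might be 0 and
    cannot be normalised; any unit vector then serves vacuously.\<close>
  have "\<exists>X :: real^4. norm X = 1"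
    using vector_choose_size[of 1] by auto
  with True assms(1) show ?thesis
    unfolding inclined_curve_def by (auto intro!: exI[of _ 0])
next
  case False
  then obtain s where s: "s \<in> I" by blast
  then have "norm (tangent \<alpha> s) = 1"
    using assms(1) by (simp add: unit_speed_curve_def)
  with inner[OF s] have Y: "norm Y \<ge> 1"
    using norm_cauchy_schwarz[of "tangent \<alpha> s" Y] by simp
  then have bounds: "-1 \<le> 1 / norm Y" "1 / norm Y \<le> 1"
    by (auto simp: divide_simps intro: order_trans[of _ "0::real"])
  define \<phi> where "\<phi> = arccos (1 / norm Y)"
  have cos: "cos \<phi> = 1 / norm Y" and range: "0 \<le> \<phi>" "\<phi> \<le> pi"
    using cos_arccos[OF bounds] arccos_lbound[OF bounds] arccos_ubound[OF bounds]
    by (simp_all only: \<phi>_def)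
  have "\<phi> \<noteq> pi / 2"
  proof
    assume "\<phi> = pi / 2"
    with cos Y show False
      by (simp only: cos_pi_half) auto
  qed
  moreover have "norm (Y /\<^sub>R norm Y) = 1"
    using Y by (cases "Y = 0") simp_all
  moreover have "\<forall>s\<in>I. tangent \<alpha> s \<bullet> (Y /\<^sub>R norm Y) = cos \<phi>"
    using inner cos by (simp add: divide_inverse)
  ultimately show ?thesis
    using assms(1) range unfolding inclined_curve_def by blast
qed

theorem corollary1:
  fixes I :: "real set" and \<alpha> M1 M2 M3 :: "real \<Rightarrow> real^4" and k1 k2 k3 :: "real \<Rightarrow> real"
  assumes "open I" and "is_interval I"
    and "unit_speed_curve I \<alpha>"
    and "parallel_transport_frame I \<alpha> M1 M2 M3"
    and "\<And>s. s \<in> I \<Longrightarrow> k1 s = frame_curvature \<alpha> M1 s"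
    and "\<And>s. s \<in> I \<Longrightarrow> k2 s = frame_curvature \<alpha> M2 s"
    and "\<And>s. s \<in> I \<Longrightarrow> k3 s = frame_curvature \<alpha> M3 s"
    and "\<And>s. s \<in> I \<Longrightarrow> k1 s \<noteq> 0 \<and> k2 s \<noteq> 0 \<and> k3 s \<noteq> 0"
  shows "inclined_curve I \<alpha> \<longleftrightarrow>
    (\<exists>K1 K2 K3 :: real \<Rightarrow> real.
       (\<forall>s\<in>I. (K1 has_real_derivative k1 s) (at s)) \<and>
       (\<forall>s\<in>I. (K2 has_real_derivative k2 s) (at s)) \<and>
       (\<forall>s\<in>I. (K3 has_real_derivative k3 s) (at s)) \<and>
       (\<forall>s\<in>I. k1 s * K1 s + k2 s * K2 s + k3 s * K3 s = 0))"
proof -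
  define T where "T = tangent \<alpha>"
  have frame: "orthonormal4 (T s) (M1 s) (M2 s) (M3 s)"
      "(T has_vector_derivative (k1 s *\<^sub>R M1 s + k2 s *\<^sub>R M2 s + k3 s *\<^sub>R M3 s)) (at s)"
      "(M1 has_vector_derivative (- k1 s *\<^sub>R T s)) (at s)"
      "(M2 has_vector_derivative (- k2 s *\<^sub>R T s)) (at s)"
      "(M3 has_vector_derivative (- k3 s *\<^sub>R T s)) (at s)" if "s \<in> I" for s
    using assms(4-7) that unfolding parallel_transport_frame_def T_def by auto
  show ?thesis
  proof
    assume "inclined_curve I \<alpha>"
    then obtain X \<phi> where \<phi>: "0 \<le> \<phi>" "\<phi> \<le> pi" "\<phi> \<noteq> pi / 2"
      and X: "\<And>s. s \<in> I \<Longrightarrow> T s \<bullet> X = cos \<phi>"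
      unfolding inclined_curve_def T_def by blast
    define c where "c = cos \<phi>"
    \<comment> \<open>The range [0, pi] matters here: cosine is injective on it, so it vanishes only
      at pi/2.\<close>
    have "c \<noteq> 0"
      using \<phi> cos_inj_pi[of \<phi> "pi / 2"] by (auto simp: c_def)
    \<comment> \<open>The equation M' = -k T turns the derivative of the inner product of M with X
      into -k c; dividing by -c leaves k. Keeping \<open>M\<close> and \<open>k\<close> general
      covers all three frame vectors.\<close>
    have anti: "((\<lambda>t. - (M t \<bullet> X) / c) has_real_derivative k) (at s)"
      if "s \<in> I" "(M has_vector_derivative (- k *\<^sub>R T s)) (at s)" for M k s
    proof -
      have "((\<lambda>t. - (M t \<bullet> X) / c) has_real_derivative - ((- k *\<^sub>R T s) \<bullet> X) / c) (at s)"
        using that(2) by (intro DERIV_cdivide DERIV_minus has_real_derivative_inner_left)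
      then show ?thesis
        using X[OF that(1)] \<open>c \<noteq> 0\<close> by (simp add: c_def)
    qed
    have orth: "k1 s * (M1 s \<bullet> X) + k2 s * (M2 s \<bullet> X) + k3 s * (M3 s \<bullet> X) = 0" if "s \<in> I" for s
    proof -
      \<comment> \<open>The inner product is known to be constant only on \<open>I\<close>; openness
        makes its two-sided derivative 0. Uniqueness of derivatives then equates this with the value
        given by the frame equation for T'.\<close>
      have "((\<lambda>t. T t \<bullet> X) has_real_derivative 0) (at s)"
        by (rule has_field_derivative_transform_within_open[of "\<lambda>_. c", OF _ \<open>open I\<close> that])
          (auto simp: X c_def)
      from DERIV_unique[OF has_real_derivative_inner_left[OF frame(2)[OF that]] this]
      show ?thesis
        by (simp add: inner_add_left)
    qed
    have "k1 s * (- (M1 s \<bullet> X) / c) + k2 s * (- (M2 s \<bullet> X) / c) + k3 s * (- (M3 s \<bullet> X) / c) = 0"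
      if "s \<in> I" for s
    proof -
      have "k1 s * (- (M1 s \<bullet> X) / c) + k2 s * (- (M2 s \<bullet> X) / c) + k3 s * (- (M3 s \<bullet> X) / c)
          = - (k1 s * (M1 s \<bullet> X) + k2 s * (M2 s \<bullet> X) + k3 s * (M3 s \<bullet> X)) / c"
        using \<open>c \<noteq> 0\<close> by (simp add: field_simps)
      then show ?thesis
        unfolding orth[OF that] by simp
    qed
    with anti[OF _ frame(3)] anti[OF _ frame(4)] anti[OF _ frame(5)] show "\<exists>K1 K2 K3 :: real \<Rightarrow> real.
       (\<forall>s\<in>I. (K1 has_real_derivative k1 s) (at s)) \<and>
       (\<forall>s\<in>I. (K2 has_real_derivative k2 s) (at s)) \<and>
       (\<forall>s\<in>I. (K3 has_real_derivative k3 s) (at s)) \<and>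
       (\<forall>s\<in>I. k1 s * K1 s + k2 s * K2 s + k3 s * K3 s = 0)"
      by (intro exI[of _ "\<lambda>t. - (M1 t \<bullet> X) / c"] exI[of _ "\<lambda>t. - (M2 t \<bullet> X) / c"]
          exI[of _ "\<lambda>t. - (M3 t \<bullet> X) / c"]) simp
  next
    assume "\<exists>K1 K2 K3 :: real \<Rightarrow> real.
       (\<forall>s\<in>I. (K1 has_real_derivative k1 s) (at s)) \<and>
       (\<forall>s\<in>I. (K2 has_real_derivative k2 s) (at s)) \<and>
       (\<forall>s\<in>I. (K3 has_real_derivative k3 s) (at s)) \<and>
       (\<forall>s\<in>I. k1 s * K1 s + k2 s * K2 s + k3 s * K3 s = 0)"
    then obtain K1 K2 K3 :: "real \<Rightarrow> real" where
      K: "\<And>s. s \<in> I \<Longrightarrow> (K1 has_real_derivative k1 s) (at s)"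
        "\<And>s. s \<in> I \<Longrightarrow> (K2 has_real_derivative k2 s) (at s)"
        "\<And>s. s \<in> I \<Longrightarrow> (K3 has_real_derivative k3 s) (at s)"
      and rel: "\<And>s. s \<in> I \<Longrightarrow> k1 s * K1 s + k2 s * K2 s + k3 s * K3 s = 0"
      by blast
    define Y where "Y s = T s - (K1 s *\<^sub>R M1 s + K2 s *\<^sub>R M2 s + K3 s *\<^sub>R M3 s)" for s
    have "(Y has_vector_derivative 0) (at s)" if "s \<in> I" for s
    proof -
      \<comment> \<open>In the product rule the terms \<open>k1 s *\<^sub>R M1 s\<close> and their
        analogues cancel T'. Only the multiples of \<open>T s\<close> coming from the derivatives of
        the \<open>M\<close> fields survive, and their total coefficient is the left side of
        \<open>rel\<close>.\<close>
      have "(Y has_vector_derivative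
          (k1 s *\<^sub>R M1 s + k2 s *\<^sub>R M2 s + k3 s *\<^sub>R M3 s)
          - ((K1 s *\<^sub>R (- k1 s *\<^sub>R T s) + k1 s *\<^sub>R M1 s)
            + (K2 s *\<^sub>R (- k2 s *\<^sub>R T s) + k2 s *\<^sub>R M2 s)
            + (K3 s *\<^sub>R (- k3 s *\<^sub>R T s) + k3 s *\<^sub>R M3 s))) (at s)"
        unfolding Y_def
        by (intro has_vector_derivative_diff has_vector_derivative_add
            has_vector_derivative_scaleR K frame that)
      also have "(k1 s *\<^sub>R M1 s + k2 s *\<^sub>R M2 s + k3 s *\<^sub>R M3 s)
          - ((K1 s *\<^sub>R (- k1 s *\<^sub>R T s) + k1 s *\<^sub>R M1 s)
            + (K2 s *\<^sub>R (- k2 s *\<^sub>R T s) + k2 s *\<^sub>R M2 s)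
            + (K3 s *\<^sub>R (- k3 s *\<^sub>R T s) + k3 s *\<^sub>R M3 s))
          = (k1 s * K1 s + k2 s * K2 s + k3 s * K3 s) *\<^sub>R T s"
        by (simp add: algebra_simps)
      finally show ?thesis
        using rel[OF that] by simp
    qed
    then have "\<And>s. s \<in> I \<Longrightarrow> (Y has_vector_derivative 0) (at s within I)"
      by (rule has_vector_derivative_at_within)
    \<comment> \<open>An interval is convex, so a zero derivative forces constancy. On
      \<open>I\<close> the squared length of \<open>Y0\<close> is 1 plus the squares of the three
      antiderivatives, so \<open>Y0\<close> still has to be normalised.\<close>
    then obtain Y0 where Y0: "\<And>s. s \<in> I \<Longrightarrow> Y s = Y0"
      using has_vector_derivative_zero_constant[of I Y] \<open>is_interval I\<close> is_interval_convex by metis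
    \<comment> \<open>Writing \<open>Y0\<close> as \<open>Y s\<close> at the same \<open>s\<close>,
      orthonormality of the frame leaves only the inner product of \<open>T s\<close> with
      itself.\<close>
    have "T s \<bullet> Y0 = 1" if "s \<in> I" for s
      using frame(1)[OF that] unfolding Y0[OF that, symmetric] Y_def orthonormal4_def
      by (simp add: inner_diff_right inner_add_right dot_square_norm)
    then show "inclined_curve I \<alpha>"
      using assms(3) inclined_curveI unfolding T_def by blast
  qed
qed

end
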